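(* Let $n\ge1$ and let $\Sigma$ be a finite set of $n\times n$ stochastic matrices. Every left-infinite product of matrices from $\Sigma$ converges to a rank one matrix if and only if every periodic left-infinite product of matrices from $\Sigma$ with period at most $p^*=\binom{n}{\lfloor n/3\rfloor}\left(2^{\,n-\lfloor n/3\rfloor-1}-1\right)$ converges to a rank one matrix.
   Context: A matrix is stochastic if it is nonnegative and each row sums to one. For a sequence $\sigma$ of indices into $\Sigma=\{A_1,\dots,A_m\}$, the left-infinite product $\dots A_{\sigma(2)}A_{\sigma(1)}$ converges to a matrix $M$ if $A_{\sigma(t)}\cdots A_{\sigma(1)}\to M$ as $t\to\infty$. The product is periodic with period $p$ if $\sigma(i+p)=\sigma(i)$ for all $i$. *)

theory Defs
  imports "HOL-Analysis.Analysis"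
begin

definition stochastic :: "real^'n^'n \<Rightarrow> bool" where
  "stochastic A \<longleftrightarrow> (\<forall>i j. A $ i $ j \<ge> 0) \<and> (\<forall>i. (\<Sum>j\<in>UNIV. A $ i $ j) = 1)"

text \<open>Left partial product: lprod s t = s t ** ... ** s 1 (and the identity for t = 0).
  The sequence is indexed from 1 as in the paper; s 0 is irrelevant.\<close>
primrec lprod :: "(nat \<Rightarrow> real^'n^'n) \<Rightarrow> nat \<Rightarrow> real^'n^'n" where
  "lprod s 0 = mat 1"
| "lprod s (Suc t) = s (Suc t) ** lprod s t"

definition lip_converges_to :: "(nat \<Rightarrow> real^'n^'n) \<Rightarrow> real^'n^'n \<Rightarrow> bool" where
  "lip_converges_to s M \<longleftrightarrow> (lprod s \<longlonglongrightarrow> M)"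

definition product_over :: "(real^'n^'n) set \<Rightarrow> (nat \<Rightarrow> real^'n^'n) \<Rightarrow> bool" where
  "product_over \<Sigma> s \<longleftrightarrow> (\<forall>i\<ge>1. s i \<in> \<Sigma>)"

definition periodic_with :: "nat \<Rightarrow> (nat \<Rightarrow> 'a) \<Rightarrow> bool" where
  "periodic_with p s \<longleftrightarrow> (\<forall>i\<ge>1. s (i + p) = s i)"

definition pstar :: "nat \<Rightarrow> nat" where
  "pstar n = (n choose (n div 3)) * (2 ^ (n - n div 3 - 1) - 1)"

end

theory Submission
  imports Defs
begin

text \<open>For a stochastic matrix \<open>A\<close> and a pair \<open>(S, T)\<close> of disjoint nonempty sets let \<open>S'\<close> and \<open>T'\<close>
  consist of the rows of \<open>A\<close> supported in \<open>S\<close> and in \<open>T\<close>. If some product maps a pair to a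
  (componentwise, up to exchanging the two components) larger one, then repeating it preserves a
  disagreement for ever, so the corresponding periodic product has no rank one limit. If this never
  happens, then by pigeonhole all sufficiently long products are scrambling, and since there are only
  finitely many of a given length, the oscillation of every vector is contracted at a uniform rate.

  In a shortest cycle of this kind the pairs are pairwise incomparable. Together with their mirror
  images they form an antichain of ordered pairs of disjoint nonempty sets, ranked by \<open>|S| + |T|\<close>.
  The antichain can be pushed to the rank \<open>n - \<lfloor>n/3\<rfloor>\<close> without loss of size, by comparing the numbers
  of upper and lower neighbours. That rank has \<open>2 * p\<^sup>*\<close> elements.\<close>

subsection \<open>Antichains of pairs of disjoint sets\<close>

text \<open>Counting the related pairs from both sides gives \<open>card H * d\<close> at most
  \<open>d\<close> times the number of neighbours of \<open>H\<close>, and \<open>d\<close>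
  cancels.\<close>

lemma double_counting_le:
  assumes "finite H" "finite Y" "0 < d"
    and lower: "\<And>x. x \<in> H \<Longrightarrow> d \<le> card {y \<in> Y. R y x}"
    and upper: "\<And>y. y \<in> Y \<Longrightarrow> card {x \<in> H. R y x} \<le> d"
  shows "card H \<le> card {y \<in> Y. \<exists>x\<in>H. R y x}"
proof -
  let ?S = "{y \<in> Y. \<exists>x\<in>H. R y x}"
  have fin: "finite ?S" using assms(2) by simp
  have "card H * d \<le> (\<Sum>x\<in>H. card {y \<in> Y. R y x})"
    using sum_bounded_below[of H d "\<lambda>x. card {y \<in> Y. R y x}"] lower by simp
  also have "\<dots> = (\<Sum>x\<in>H. card {y \<in> ?S. R y x})"
    by (intro sum.cong refl arg_cong[where f = card]) auto
  also have "\<dots> = (\<Sum>y\<in>?S. card {x \<in> H. R y x})"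
    using sum_multicount_gen[OF assms(1) fin, where R = "\<lambda>x y. R y x" and k = "\<lambda>y. card {x \<in> H. R y x}"]
    by simp
  also have "\<dots> \<le> card ?S * d"
    using sum_bounded_above[of ?S "\<lambda>y. card {x \<in> H. R y x}" d] upper by simp
  finally show ?thesis using assms(3) by simp
qed

text \<open>Every element of the topmost rank is replaced by its shadow one rank below, which does not
  decrease the size and keeps the family an antichain, until rank \<open>K\<close> is reached.\<close>
lemma antichain_push_down:
  fixes f :: "'a \<Rightarrow> nat"
  assumes "finite X"
    and trans: "\<And>x y z. R x y \<Longrightarrow> R y z \<Longrightarrow> R x z"
    and rank: "\<And>x y. x \<in> X \<Longrightarrow> y \<in> X \<Longrightarrow> R x y \<Longrightarrow> f x < f y"
    and expand: "\<And>k H. K \<le> k \<Longrightarrow> H \<subseteq> {x \<in> X. f x = Suc k} \<Longrightarrow>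
        card H \<le> card {y \<in> {y \<in> X. f y = k}. \<exists>x\<in>H. R y x}"
    and "G \<subseteq> X" and anti: "\<And>x y. x \<in> G \<Longrightarrow> y \<in> G \<Longrightarrow> \<not> R x y"
  obtains G' where "G' \<subseteq> X" "\<And>x y. x \<in> G' \<Longrightarrow> y \<in> G' \<Longrightarrow> \<not> R x y"
    "card G \<le> card G'" "\<And>x. x \<in> G' \<Longrightarrow> f x \<le> K" "\<And>x. x \<in> G' \<Longrightarrow> f x < K \<Longrightarrow> x \<in> G"
proof -
  \<comment> \<open>No new element appears below rank \<open>K\<close>. A later push in the reversed
    order relies on this to keep the bound reached by the first one.\<close>
  have push: "\<exists>G'\<subseteq>X. (\<forall>x\<in>G'. \<forall>y\<in>G'. \<not> R x y) \<and> card G \<le> card G' \<and>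
      (\<forall>x\<in>G'. f x \<le> K \<and> (f x < K \<longrightarrow> x \<in> G))"
    if "G \<subseteq> X" "\<forall>x\<in>G. \<forall>y\<in>G. \<not> R x y" "\<forall>x\<in>G. f x \<le> K + m" for G m
    using that
  proof (induction m arbitrary: G)
    case 0
    then show ?case by (intro exI[of _ G]) auto
  next
    case (Suc m)
    let ?H = "{x \<in> G. f x = Suc (K + m)}"
    let ?S = "{y \<in> {y \<in> X. f y = K + m}. \<exists>x\<in>?H. R y x}"
    let ?G = "(G - ?H) \<union> ?S"
    have finG: "finite G" using Suc.prems(1) assms(1) finite_subset by blast
    have le: "card ?H \<le> card ?S"
      using Suc.prems(1) by (intro expand) auto
    \<comment> \<open>A shadow element is \<open>R\<close>-below some element of \<open>?H\<close>,
      so it cannot lie in the antichain \<open>G\<close> itself.\<close>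
    have "(G - ?H) \<inter> ?S = {}"
      using Suc.prems(2) by blast
    then have "card ?G = card (G - ?H) + card ?S"
      using assms(1) finG by (intro card_Un_disjoint) auto
    moreover have "card (G - ?H) = card G - card ?H"
      using finG by (intro card_Diff_subset) auto
    moreover have "card ?H \<le> card G" using finG by (intro card_mono) auto
    ultimately have card: "card G \<le> card ?G" using le by linarith
    have sub: "?G \<subseteq> X" using Suc.prems(1) by auto
    have ranks: "\<forall>x\<in>?G. f x \<le> K + m"
      using Suc.prems(3) by (auto simp: le_Suc_eq)
    have "\<forall>x\<in>?G. \<forall>y\<in>?G. \<not> R x y"
    proof (intro ballI notI)
      fix x y assume xy: "x \<in> ?G" "y \<in> ?G" "R x y"
      then have lt: "f x < f y" using rank sub by blast
      from xy(1) show False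
      proof
        assume x: "x \<in> G - ?H"
        from xy(2) show False
        proof
          assume "y \<in> G - ?H" then show False using x xy(3) Suc.prems(2) by blast
        next
          assume "y \<in> ?S" then show False using x xy(3) Suc.prems(2) trans by blast
        qed
      next
        assume "x \<in> ?S"
        then have "f x = K + m" by simp
        then show False using lt bspec[OF ranks xy(2)] by linarith
      qed
    qed
    from Suc.IH[OF sub this ranks] obtain G' where G': "G' \<subseteq> X" "\<forall>x\<in>G'. \<forall>y\<in>G'. \<not> R x y"
      "card ?G \<le> card G'" "\<forall>x\<in>G'. f x \<le> K \<and> (f x < K \<longrightarrow> x \<in> ?G)" by blast
    then show ?case using card by (intro exI[of _ G']) auto
  qed
  have "finite G" using assms(1,5) finite_subset by blast
  then have "\<forall>x\<in>G. f x \<le> K + Max (f ` G)"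
    by (auto intro: trans_le_add2)
  then show ?thesis using push[of G "Max (f ` G)"] assms(5) anti that by blast
qed

section \<open>The ranked order of pairs of disjoint nonempty sets\<close>

definition disjoint_pairs :: "('n set \<times> 'n set) set" where
  "disjoint_pairs = {(A, B). A \<noteq> {} \<and> B \<noteq> {} \<and> A \<inter> B = {}}"

definition pair_size :: "'n set \<times> 'n set \<Rightarrow> nat" where
  "pair_size P = card (fst P) + card (snd P)"

lemma pair_size_less:
  fixes P Q :: "('n::finite) set \<times> 'n set"
  assumes "P < Q"
  shows "pair_size P < pair_size Q"
proof -
  obtain A B C D where PQ: "P = (A, B)" "Q = (C, D)" by (cases P, cases Q)
  have sub: "A \<subseteq> C" "B \<subseteq> D" and "A \<subset> C \<or> B \<subset> D"
    using assms by (auto simp: PQ less_prod_def less_eq_prod_def)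
  then have "card A < card C \<or> card B < card D" by (meson finite psubset_card_mono)
  moreover have "card A \<le> card C" "card B \<le> card D" using sub by (auto intro: card_mono)
  ultimately show ?thesis by (auto simp: PQ pair_size_def)
qed

lemma pair_size_le:
  fixes P :: "('n::finite) set \<times> 'n set"
  assumes "P \<in> disjoint_pairs"
  shows "pair_size P \<le> CARD('n)"
proof -
  obtain A B where "P = (A, B)" "A \<inter> B = {}" using assms by (auto simp: disjoint_pairs_def)
  then show ?thesis
    using card_Un_disjoint[of A B] card_mono[of UNIV "A \<union> B"] by (simp add: pair_size_def)
qed

text \<open>An upper neighbour adds one of the \<open>n - k\<close> points outside both sets to
  either of the two components.\<close>

lemma card_covers:
  fixes P :: "('n::finite) set \<times> 'n set"
  assumes P: "P \<in> disjoint_pairs" "pair_size P = k"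
  shows "card {Q \<in> disjoint_pairs. pair_size Q = Suc k \<and> P < Q} = 2 * (CARD('n) - k)"
proof -
  obtain A B where PAB: "P = (A, B)" "A \<noteq> {}" "B \<noteq> {}" "A \<inter> B = {}"
    using P(1) by (auto simp: disjoint_pairs_def)
  let ?l = "\<lambda>c. (insert c A, B)" and ?r = "\<lambda>c. (A, insert c B)" and ?U = "- (A \<union> B)"
  have "{Q \<in> disjoint_pairs. pair_size Q = Suc k \<and> P < Q} = ?l ` ?U \<union> ?r ` ?U"
  proof (intro equalityI subsetI)
    fix Q assume "Q \<in> {Q \<in> disjoint_pairs. pair_size Q = Suc k \<and> P < Q}"
    then obtain C D where Q: "Q = (C, D)" "C \<inter> D = {}" "A \<subseteq> C" "B \<subseteq> D"
        "card C + card D = Suc (card A + card B)"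
      using P(2) by (auto simp: PAB(1) disjoint_pairs_def pair_size_def less_prod_def less_eq_prod_def)
    have "card A \<le> card C" "card B \<le> card D" using Q by (auto intro: card_mono)
    then consider "card C = Suc (card A)" "card D = card B" | "card D = Suc (card B)" "card C = card A"
      using Q(5) by linarith
    then show "Q \<in> ?l ` ?U \<union> ?r ` ?U"
    proof cases
      case 1
      then have "D = B" using Q(4) by (metis card_subset_eq finite)
      have "card (C - A) = 1" using 1 Q(3) by (simp add: card_Diff_subset)
      then obtain c where "C - A = {c}" by (auto simp: card_1_singleton_iff)
      then have "C = insert c A" "c \<notin> A" using Q(3) by auto
      then show ?thesis using \<open>D = B\<close> Q(1,2) by auto
    next
      case 2
      then have "C = A" using Q(3) by (metis card_subset_eq finite)
      have "card (D - B) = 1" using 2 Q(4) by (simp add: card_Diff_subset)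
      then obtain c where "D - B = {c}" by (auto simp: card_1_singleton_iff)
      then have "D = insert c B" "c \<notin> B" using Q(4) by auto
      then show ?thesis using \<open>C = A\<close> Q(1,2) by auto
    qed
  next
    fix Q assume "Q \<in> ?l ` ?U \<union> ?r ` ?U"
    then show "Q \<in> {Q \<in> disjoint_pairs. pair_size Q = Suc k \<and> P < Q}"
      using P(2) PAB by (auto simp: disjoint_pairs_def pair_size_def less_prod_def less_eq_prod_def)
  qed
  moreover have "card (?l ` ?U \<union> ?r ` ?U) = card (?l ` ?U) + card (?r ` ?U)"
    by (intro card_Un_disjoint) auto
  moreover have "card (?l ` ?U) = card ?U" "card (?r ` ?U) = card ?U"
    by (intro card_image; auto simp: inj_on_def)+
  moreover have "card ?U = CARD('n) - k"
    using P(2) PAB card_Un_disjoint[of A B] by (simp add: card_Diff_subset Compl_eq_Diff_UNIV pair_size_def)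
  ultimately show ?thesis by simp
qed

text \<open>A lower neighbour drops one of the \<open>k + 1\<close> points. Only the point of a
  singleton component cannot be dropped, and for \<open>2 \<le> k\<close> at most one component is a
  singleton.\<close>

lemma card_cocovers:
  fixes P :: "('n::finite) set \<times> 'n set"
  assumes P: "P \<in> disjoint_pairs" "pair_size P = Suc k"
  shows "card {Q \<in> disjoint_pairs. pair_size Q = k \<and> Q < P} \<le> Suc k"
    and "2 \<le> k \<Longrightarrow> k \<le> card {Q \<in> disjoint_pairs. pair_size Q = k \<and> Q < P}"
proof -
  obtain A B where PAB: "P = (A, B)" "A \<noteq> {}" "B \<noteq> {}" "A \<inter> B = {}"
    using P(1) by (auto simp: disjoint_pairs_def)
  let ?l = "\<lambda>c. (A - {c}, B)" and ?r = "\<lambda>c. (A, B - {c})"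
  let ?L = "{Q \<in> disjoint_pairs. pair_size Q = k \<and> Q < P}"
  have AB: "card A + card B = Suc k" using P(2) PAB(1) by (simp add: pair_size_def)
  have cl: "card (?l ` A) = card A" and cr: "card (?r ` B) = card B"
    by (intro card_image; auto simp: inj_on_def)+
  have cu: "card (?l ` A \<union> ?r ` B) = Suc k"
    using AB cl cr by (subst card_Un_disjoint) auto
  have "?L \<subseteq> ?l ` A \<union> ?r ` B"
  proof
    fix Q assume "Q \<in> ?L"
    then obtain C D where Q: "Q = (C, D)" "C \<subseteq> A" "D \<subseteq> B" "card A + card B = Suc (card C + card D)"
      using AB by (cases Q) (auto simp: PAB(1) pair_size_def less_prod_def less_eq_prod_def)
    have "card C \<le> card A" "card D \<le> card B" using Q by (auto intro: card_mono)
    then consider "card A = Suc (card C)" "card D = card B" | "card B = Suc (card D)" "card C = card A"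
      using Q(4) by linarith
    then show "Q \<in> ?l ` A \<union> ?r ` B"
    proof cases
      case 1
      then have "D = B" using Q(3) by (metis card_subset_eq finite)
      have "card (A - C) = 1" using 1 Q(2) by (simp add: card_Diff_subset)
      then obtain c where "A - C = {c}" by (auto simp: card_1_singleton_iff)
      then have "C = A - {c}" "c \<in> A" using Q(2) by auto
      then show ?thesis using \<open>D = B\<close> Q(1) by auto
    next
      case 2
      then have "C = A" using Q(2) by (metis card_subset_eq finite)
      have "card (B - D) = 1" using 2 Q(3) by (simp add: card_Diff_subset)
      then obtain c where "B - D = {c}" by (auto simp: card_1_singleton_iff)
      then have "D = B - {c}" "c \<in> B" using Q(3) by auto
      then show ?thesis using \<open>C = A\<close> Q(1) by auto
    qed
  qed
  from card_mono[OF _ this] show "card ?L \<le> Suc k" using cu by simp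
  assume k: "2 \<le> k"
  have posA: "0 < card A" and posB: "0 < card B" using PAB by (auto simp: card_gt_0_iff)
  have l: "?l ` A \<subseteq> ?L" if "2 \<le> card A"
  proof
    fix Q assume "Q \<in> ?l ` A"
    then obtain c where c: "c \<in> A" "Q = (A - {c}, B)" by auto
    have "card (A - {c}) = card A - 1" using c by simp
    moreover from this have "A - {c} \<noteq> {}" using that by (metis card.empty diff_is_0_eq not_less_eq_eq numeral_2_eq_2 One_nat_def)
    ultimately show "Q \<in> ?L"
      using c PAB AB that by (auto simp: disjoint_pairs_def pair_size_def less_prod_def less_eq_prod_def)
  qed
  have r: "?r ` B \<subseteq> ?L" if "2 \<le> card B"
  proof
    fix Q assume "Q \<in> ?r ` B"
    then obtain c where c: "c \<in> B" "Q = (A, B - {c})" by auto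
    have "card (B - {c}) = card B - 1" using c by simp
    moreover from this have "B - {c} \<noteq> {}" using that by (metis card.empty diff_is_0_eq not_less_eq_eq numeral_2_eq_2 One_nat_def)
    ultimately show "Q \<in> ?L"
      using c PAB AB that by (auto simp: disjoint_pairs_def pair_size_def less_prod_def less_eq_prod_def)
  qed
  consider "2 \<le> card A" "2 \<le> card B" | "2 \<le> card A" "card B = 1" | "card A = 1" "2 \<le> card B"
    using posA posB AB k by linarith
  then show "k \<le> card ?L"
  proof cases
    case 1
    then have "?l ` A \<union> ?r ` B \<subseteq> ?L" using l r by blast
    from card_mono[OF _ this] show ?thesis using cu by simp
  next
    case 2
    from card_mono[OF _ l[OF 2(1)]] show ?thesis using cl AB 2(2) by simp
  next
    case 3
    from card_mono[OF _ r[OF 3(2)]] show ?thesis using cr AB 3(1) by simp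
  qed
qed

text \<open>Choose the union \<open>U\<close> of the two sets, then the first component as a subset
  of \<open>U\<close> other than \<open>{}\<close> and \<open>U\<close>.\<close>

lemma card_disjoint_pairs_level:
  assumes "0 < k"
  shows "card {P \<in> disjoint_pairs :: (('n::finite) set \<times> 'n set) set. pair_size P = k} = (CARD('n) choose k) * (2 ^ k - 2)"
proof -
  let ?I = "Sigma {U :: 'n set. card U = k} (\<lambda>U. Pow U - {{}, U})"
  have "{P \<in> disjoint_pairs :: ('n set \<times> 'n set) set. pair_size P = k} = (\<lambda>(U, A). (A, U - A)) ` ?I"
  proof (intro equalityI subsetI)
    fix P :: "'n set \<times> 'n set" assume "P \<in> {P \<in> disjoint_pairs. pair_size P = k}"
    then obtain A B where "P = (A, B)" "A \<noteq> {}" "B \<noteq> {}" "A \<inter> B = {}" "card A + card B = k"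
      by (cases P) (auto simp: disjoint_pairs_def pair_size_def)
    then have "(A \<union> B, A) \<in> ?I" "P = (\<lambda>(U, A). (A, U - A)) (A \<union> B, A)"
      by (auto simp: card_Un_disjoint)
    then show "P \<in> (\<lambda>(U, A). (A, U - A)) ` ?I" by (rule rev_image_eqI)
  next
    fix P :: "'n set \<times> 'n set" assume "P \<in> (\<lambda>(U, A). (A, U - A)) ` ?I"
    then obtain U A where "P = (A, U - A)" "card U = k" "A \<subseteq> U" "A \<noteq> {}" "A \<noteq> U" by auto
    moreover from this have "card A + card (U - A) = k"
      by (metis card_Diff_subset card_mono finite le_add_diff_inverse)
    ultimately show "P \<in> {P \<in> disjoint_pairs. pair_size P = k}"
      by (auto simp: disjoint_pairs_def pair_size_def)
  qed
  moreover have "inj_on (\<lambda>(U, A). (A, U - A)) ?I" by (auto simp: inj_on_def)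
  moreover have "card ?I = (\<Sum>U :: 'n set | card U = k. card (Pow U - {{}, U}))"
    by (rule card_SigmaI) auto
  moreover have "card (Pow U - {{}, U}) = 2 ^ k - 2" if "card U = k" for U :: "'n set"
  proof -
    have "U \<noteq> {}" using that assms by auto
    then show ?thesis using that by (subst card_Diff_subset) (auto simp: card_Pow)
  qed
  moreover have "card {U :: 'n set. card U = k} = CARD('n) choose k"
    using n_subsets[of "UNIV :: 'n set" k] by simp
  ultimately show ?thesis by (simp add: card_image)
qed

text \<open>There are \<open>2 * (n - k)\<close> upper neighbours at rank \<open>k\<close> against
  \<open>k\<close> or \<open>k + 1\<close> lower ones at rank \<open>k + 1\<close>. These numbers
  balance near \<open>2n/3\<close>, so pushing down from above and up from below loses no
  elements.\<close>

lemma card_antichain_disjoint_pairs_le: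
  fixes G :: "(('n::finite) set \<times> 'n set) set"
  assumes "G \<subseteq> disjoint_pairs" and anti: "\<And>P Q. P \<in> G \<Longrightarrow> Q \<in> G \<Longrightarrow> \<not> P < Q"
  shows "card G \<le> 2 * pstar CARD('n)"
proof -
  let ?X = "disjoint_pairs :: ('n set \<times> 'n set) set"
  let ?n = "CARD('n)"
  define K where "K = ?n - ?n div 3"
  have n: "0 < ?n" by simp
  \<comment> \<open>The third bound yields \<open>2 * (n - k) \<le> k\<close> for
    \<open>k \<ge> K\<close>, used to push down; the fourth yields
    \<open>k + 1 \<le> 2 * (n - k)\<close> for \<open>k < K\<close>, used to push up.\<close>
  have K: "0 < K" "K \<le> ?n" "2 * ?n \<le> 3 * K" "3 * K \<le> 2 * ?n + 2"
    using n unfolding K_def by presburger+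
  obtain G1 where G1: "G1 \<subseteq> ?X" "\<And>P Q. P \<in> G1 \<Longrightarrow> Q \<in> G1 \<Longrightarrow> \<not> P < Q"
    "card G \<le> card G1" "\<And>P. P \<in> G1 \<Longrightarrow> pair_size P \<le> K"
  proof (rule antichain_push_down[of ?X "(<)" pair_size K G])
    fix k and H :: "('n set \<times> 'n set) set"
    assume k: "K \<le> k" and H: "H \<subseteq> {P \<in> ?X. pair_size P = Suc k}"
    show "card H \<le> card {Q \<in> {Q \<in> ?X. pair_size Q = k}. \<exists>P\<in>H. Q < P}"
    proof (cases "H = {}")
      case False
      then obtain P where "P \<in> H" by blast
      then have "Suc k \<le> ?n" using H pair_size_le[of P] by auto
      \<comment> \<open>From \<open>2n \<le> 3k\<close> and \<open>k + 1 \<le> n\<close> it follows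
        that \<open>k \<ge> 2\<close>. This avoids rank 2, where both components are singletons and
        nothing lies below.\<close>
      then have k2: "2 \<le> k" "2 * (?n - k) \<le> k" using k K by linarith+
      show ?thesis
      proof (rule double_counting_le[where d = k])
        fix P assume "P \<in> H"
        then show "k \<le> card {Q \<in> {Q \<in> ?X. pair_size Q = k}. Q < P}"
          using H card_cocovers(2)[of P k] k2 by (auto simp: conj_assoc)
      next
        fix Q assume "Q \<in> {Q \<in> ?X. pair_size Q = k}"
        moreover have "card {P \<in> H. Q < P} \<le> card {P \<in> ?X. pair_size P = Suc k \<and> Q < P}"
          using H by (intro card_mono) auto
        ultimately show "card {P \<in> H. Q < P} \<le> k"
          using card_covers[of Q k] k2 by auto
      qed (use k2 in auto)
    qed simp
  next
    fix G' assume "G' \<subseteq> ?X" "\<And>P Q. P \<in> G' \<Longrightarrow> Q \<in> G' \<Longrightarrow> \<not> P < Q"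
      "card G \<le> card G'" "\<And>P. P \<in> G' \<Longrightarrow> pair_size P \<le> K"
    then show thesis by (rule that)
  next
    fix P Q R :: "'n set \<times> 'n set" assume "P < Q" "Q < R"
    then show "P < R" by (rule less_trans)
  next
    fix P Q assume "P \<in> G" "Q \<in> G"
    then show "\<not> P < Q" by (rule anti)
  qed (rule finite assms(1) | erule pair_size_less)+
  \<comment> \<open>Pushing up is pushing down in the reversed order, ranked by corank.\<close>
  obtain G2 where G2: "G2 \<subseteq> ?X" "card G1 \<le> card G2"
    "\<And>P. P \<in> G2 \<Longrightarrow> ?n - pair_size P \<le> ?n - K"
    "\<And>P. P \<in> G2 \<Longrightarrow> ?n - pair_size P < ?n - K \<Longrightarrow> P \<in> G1"
  proof (rule antichain_push_down[of ?X "(>)" "\<lambda>P. ?n - pair_size P" "?n - K" G1])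
    fix P Q :: "'n set \<times> 'n set" assume "P \<in> ?X" "Q \<in> ?X" "P > Q"
    then show "?n - pair_size P < ?n - pair_size Q"
      using pair_size_less[of Q P] pair_size_le[of P] by linarith
  next
    fix m and H :: "('n set \<times> 'n set) set"
    assume m: "?n - K \<le> m" and H: "H \<subseteq> {P \<in> ?X. ?n - pair_size P = Suc m}"
    show "card H \<le> card {Q \<in> {Q \<in> ?X. ?n - pair_size Q = m}. \<exists>P\<in>H. P < Q}"
    proof (cases "H = {}")
      case False
      then have mn: "Suc m \<le> ?n" using H by auto
      define k where "k = ?n - Suc m"
      have k: "Suc k \<le> K" "k < ?n" "Suc k \<le> 2 * (?n - k)" using mn m K unfolding k_def by linarith+
      have iff: "?n - pair_size P = Suc m \<longleftrightarrow> pair_size P = k"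
        "?n - pair_size P = m \<longleftrightarrow> pair_size P = Suc k" if "P \<in> ?X" for P
        using pair_size_le[OF that] mn unfolding k_def by linarith+
      have level: "{Q \<in> ?X. ?n - pair_size Q = m} = {Q \<in> ?X. pair_size Q = Suc k}"
        and H': "H \<subseteq> {P \<in> ?X. pair_size P = k}"
        using H iff by blast+
      show ?thesis unfolding level
      proof (rule double_counting_le[where d = "Suc k"])
        fix P assume "P \<in> H"
        then show "Suc k \<le> card {Q \<in> {Q \<in> ?X. pair_size Q = Suc k}. P < Q}"
          using H' card_covers[of P k] k by (auto simp: conj_assoc)
      next
        fix Q assume "Q \<in> {Q \<in> ?X. pair_size Q = Suc k}"
        moreover have "card {P \<in> H. P < Q} \<le> card {P \<in> ?X. pair_size P = k \<and> P < Q}"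
          using H' by (intro card_mono) auto
        ultimately show "card {P \<in> H. P < Q} \<le> Suc k"
          using card_cocovers(1)[of Q k] by force
      qed auto
    qed simp
  next
    fix P Q R :: "'n set \<times> 'n set" assume "P > Q" "Q > R"
    then show "P > R" by (rule less_trans[rotated])
  next
    fix P Q assume "P \<in> G1" "Q \<in> G1"
    then show "\<not> P > Q" using G1(2) by blast
  next
    fix G' assume "G' \<subseteq> ?X" "card G1 \<le> card G'"
      "\<And>P. P \<in> G' \<Longrightarrow> ?n - pair_size P \<le> ?n - K"
      "\<And>P. P \<in> G' \<Longrightarrow> ?n - pair_size P < ?n - K \<Longrightarrow> P \<in> G1"
    then show thesis by (rule that)
  qed (rule finite G1(1))+
  \<comment> \<open>The corank bound says that sizes are at least \<open>K\<close>. An element of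
    larger size would come unchanged from \<open>G1\<close>, where sizes are at most
    \<open>K\<close>.\<close>
  have "G2 \<subseteq> {P \<in> ?X. pair_size P = K}"
  proof
    fix P assume P: "P \<in> G2"
    then have "pair_size P \<le> ?n" using G2(1) pair_size_le by blast
    moreover have "pair_size P \<le> K \<or> ?n - pair_size P < ?n - K"
      using K \<open>pair_size P \<le> ?n\<close> by linarith
    ultimately have "pair_size P = K" using G1(4) G2(3,4)[OF P] K by fastforce
    then show "P \<in> {P \<in> ?X. pair_size P = K}" using P G2(1) by auto
  qed
  then have "card G2 \<le> card {P \<in> ?X. pair_size P = K}"
    by (intro card_mono) auto
  also have "\<dots> = (?n choose K) * (2 ^ K - 2)"
    by (rule card_disjoint_pairs_level[OF K(1)])
  also have "?n choose K = ?n choose (?n div 3)"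
    using binomial_symmetric[of "?n div 3" ?n] by (simp add: K_def)
  also have "2 ^ K - 2 = 2 * (2 ^ (K - 1) - 1 :: nat)"
    using K(1) by (cases K) auto
  finally show ?thesis using G1(3) G2(2) by (simp add: pstar_def K_def)
qed

subsection \<open>Stochastic matrices and their products\<close>

lemma stochastic_nonneg: "stochastic A \<Longrightarrow> 0 \<le> A $ i $ j"
  by (simp add: stochastic_def)

lemma stochastic_row_sum: "stochastic A \<Longrightarrow> (\<Sum>j\<in>UNIV. A $ i $ j) = 1"
  by (simp add: stochastic_def)

lemma stochastic_row_nonzero:
  assumes "stochastic A"
  shows "\<exists>j. A $ i $ j \<noteq> 0"
  using stochastic_row_sum[OF assms, of i] by (metis sum.neutral zero_neq_one)

lemma stochastic_mat_1: "stochastic (mat 1)"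
  by (simp add: stochastic_def mat_def)

lemma stochastic_mult:
  assumes "stochastic A" "stochastic B"
  shows "stochastic (A ** B)"
proof -
  have "(\<Sum>j\<in>UNIV. (A ** B) $ i $ j) = 1" for i
  proof -
    have "(\<Sum>j\<in>UNIV. (A ** B) $ i $ j) = (\<Sum>k\<in>UNIV. \<Sum>j\<in>UNIV. A $ i $ k * B $ k $ j)"
      by (subst sum.swap) (simp add: matrix_matrix_mult_def)
    also have "\<dots> = 1"
      using assms by (simp add: sum_distrib_left[symmetric] stochastic_row_sum)
    finally show ?thesis .
  qed
  moreover have "0 \<le> (A ** B) $ i $ j" for i j
    using assms by (auto simp: matrix_matrix_mult_def stochastic_nonneg intro!: sum_nonneg)
  ultimately show ?thesis by (simp add: stochastic_def)
qed

section \<open>Left products of stochastic matrices\<close>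

lemma product_over_shift: "product_over \<Sigma> s \<Longrightarrow> product_over \<Sigma> (\<lambda>i. s (i + m))"
  by (simp add: product_over_def)

lemma stochastic_lprod:
  assumes "\<forall>A\<in>\<Sigma>. stochastic A" "product_over \<Sigma> s"
  shows "stochastic (lprod s t)"
  using assms by (induction t) (auto simp: stochastic_mat_1 product_over_def intro: stochastic_mult)

lemma lprod_cong: "(\<And>i. 1 \<le> i \<Longrightarrow> i \<le> t \<Longrightarrow> s i = s' i) \<Longrightarrow> lprod s t = lprod s' t"
  by (induction t) auto

lemma lprod_add: "lprod s (m + t) = lprod (\<lambda>i. s (i + m)) t ** lprod s m"
  by (induction t) (simp_all add: matrix_mul_assoc add.commute)

lemma finite_lprods:
  assumes "finite \<Sigma>"
  shows "finite {lprod s t | s. product_over \<Sigma> s}"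
proof (induction t)
  case (Suc t)
  have "{lprod s (Suc t) | s. product_over \<Sigma> s}
      \<subseteq> (\<lambda>(A, W). A ** W) ` (\<Sigma> \<times> {lprod s t | s. product_over \<Sigma> s})"
    by (force simp: product_over_def)
  then show ?case using Suc assms by (meson finite_SigmaI finite_imageI finite_subset)
qed simp

text \<open>All rows are multiples of one nonzero row, and equal row sums force the factor to be
  1.\<close>

lemma rank_1_imp_rows_eq:
  fixes M :: "real^'n^'n"
  assumes "rank M = 1" and sums: "\<And>i. (\<Sum>j\<in>UNIV. M $ i $ j) = 1"
  shows "M $ i = M $ k"
proof -
  have nz: "M $ k \<noteq> 0" using sums[of k] by auto
  have rows: "M $ i \<in> rows M" "M $ k \<in> rows M" by (auto simp: rows_def row_def vec_lambda_eta)
  have "dim (rows M) \<le> dim {M $ k}"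
    using assms(1) nz by (simp add: row_rank_def dim_insert)
  then have "span {M $ k} = span (rows M)"
    using rows(2) by (intro dim_eq_span) auto
  then have "M $ i \<in> span {M $ k}" using rows(1) span_base by blast
  then obtain c where c: "M $ i = c *\<^sub>R M $ k" by (auto simp: span_singleton)
  have "(\<Sum>j\<in>UNIV. M $ i $ j) = c * (\<Sum>j\<in>UNIV. M $ k $ j)"
    by (simp add: c sum_distrib_left)
  then have "c = 1" unfolding sums by simp
  then show ?thesis using c by simp
qed

lemma rank_constant_rows:
  fixes v :: "real^'n"
  assumes "v \<noteq> 0"
  shows "rank (\<chi> i. v :: real^'n^'m) = 1"
proof -
  have "rows (\<chi> i. v :: real^'n^'m) = {v}"
    by (auto simp: rows_def row_def vec_lambda_eta)
  then show ?thesis using assms by (simp add: row_rank_def dim_insert)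
qed

subsection \<open>Pairs of disjoint sets under stochastic matrices\<close>

text \<open>If \<open>x\<close> is \<open>1\<close> on \<open>S\<close>, \<open>0\<close> on \<open>T\<close> and strictly between elsewhere, then \<open>A *v x\<close> takes the
  value \<open>1\<close> exactly on \<open>rows_inside A S\<close> and \<open>0\<close> exactly on \<open>rows_inside A T\<close>.\<close>
definition rows_inside :: "real^'n^'n \<Rightarrow> 'n set \<Rightarrow> 'n set" where
  "rows_inside A S = {i. \<forall>j. A $ i $ j \<noteq> 0 \<longrightarrow> j \<in> S}"

definition pair_step :: "real^'n^'n \<Rightarrow> 'n set \<times> 'n set \<Rightarrow> 'n set \<times> 'n set" where
  "pair_step A P = (rows_inside A (fst P), rows_inside A (snd P))"

text \<open>The swap treats pairs as unordered: a product that exchanges the values 1 and 0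
  preserves the disagreement just as well.\<close>

definition pair_le :: "'n set \<times> 'n set \<Rightarrow> 'n set \<times> 'n set \<Rightarrow> bool" where
  "pair_le P Q \<longleftrightarrow> P \<le> Q \<or> prod.swap P \<le> Q"

text \<open>Nonnegative terms cannot cancel, so the zero pattern of a product depends only on the
  zero patterns of its factors.\<close>

lemma rows_inside_mult:
  assumes "stochastic A" "stochastic B"
  shows "rows_inside (A ** B) S = rows_inside A (rows_inside B S)"
proof -
  have "(A ** B) $ i $ j = 0 \<longleftrightarrow> (\<forall>k. A $ i $ k = 0 \<or> B $ k $ j = 0)" for i j
    using assms by (simp add: matrix_matrix_mult_def sum_nonneg_eq_0_iff stochastic_nonneg)
  then show ?thesis unfolding rows_inside_def by auto
qed

lemma pair_step_mult:
  "stochastic A \<Longrightarrow> stochastic B \<Longrightarrow> pair_step (A ** B) P = pair_step A (pair_step B P)"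
  by (simp add: pair_step_def rows_inside_mult)

lemma pair_step_mat_1 [simp]: "pair_step (mat 1) P = P"
  by (cases P) (auto simp: pair_step_def rows_inside_def mat_def)

lemma pair_le_refl: "pair_le P P"
  by (simp add: pair_le_def)

lemma pair_le_trans: "pair_le P Q \<Longrightarrow> pair_le Q R \<Longrightarrow> pair_le P R"
  by (cases P; cases Q; cases R) (auto simp: pair_le_def)

lemma pair_step_mono: "pair_le P Q \<Longrightarrow> pair_le (pair_step A P) (pair_step A Q)"
  by (cases P; cases Q) (auto simp: pair_le_def pair_step_def rows_inside_def)

lemma pair_step_disjoint:
  assumes "stochastic A" "fst P \<inter> snd P = {}"
  shows "fst (pair_step A P) \<inter> snd (pair_step A P) = {}"
proof (rule ccontr)
  assume "fst (pair_step A P) \<inter> snd (pair_step A P) \<noteq> {}"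
  then obtain i where i: "i \<in> rows_inside A (fst P)" "i \<in> rows_inside A (snd P)"
    by (auto simp: pair_step_def)
  obtain j where "A $ i $ j \<noteq> 0" using stochastic_row_nonzero[OF assms(1)] by blast
  then show False using i assms(2) by (auto simp: rows_inside_def)
qed

lemma disjoint_pairs_iff: "P \<in> disjoint_pairs \<longleftrightarrow> fst P \<noteq> {} \<and> snd P \<noteq> {} \<and> fst P \<inter> snd P = {}"
  by (cases P) (simp add: disjoint_pairs_def)

text \<open>An empty component stays empty, since no row of a stochastic matrix vanishes.\<close>

lemma pair_step_in_disjoint_pairsD:
  assumes "stochastic A" "pair_step A P \<in> disjoint_pairs" "fst P \<inter> snd P = {}"
  shows "P \<in> disjoint_pairs"
proof -
  have "rows_inside A {} = {}"
    using stochastic_row_nonzero[OF assms(1)] by (auto simp: rows_inside_def)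
  then show ?thesis using assms(2,3) by (auto simp: disjoint_pairs_iff pair_step_def)
qed

lemma disjoint_pairs_pair_le:
  "P \<in> disjoint_pairs \<Longrightarrow> pair_le P Q \<Longrightarrow> fst Q \<inter> snd Q = {} \<Longrightarrow> Q \<in> disjoint_pairs"
  by (cases P; cases Q) (auto simp: disjoint_pairs_def pair_le_def)

section \<open>Pairs along a left product and their cycles\<close>

lemma pair_step_lprod_add:
  assumes "\<forall>A\<in>\<Sigma>. stochastic A" "product_over \<Sigma> s"
  shows "pair_step (lprod s (m + t)) P =
    pair_step (lprod (\<lambda>i. s (i + m)) t) (pair_step (lprod s m) P)"
  unfolding lprod_add using assms
  by (intro pair_step_mult) (auto intro: stochastic_lprod product_over_shift)

lemma pair_step_lprod_prefix:
  assumes "\<forall>A\<in>\<Sigma>. stochastic A" "product_over \<Sigma> s" "P \<in> disjoint_pairs" "m \<le> t"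
    and "pair_step (lprod s t) P \<in> disjoint_pairs"
  shows "pair_step (lprod s m) P \<in> disjoint_pairs"
proof -
  have "pair_step (lprod (\<lambda>i. s (i + m)) (t - m)) (pair_step (lprod s m) P) \<in> disjoint_pairs"
    using pair_step_lprod_add[OF assms(1,2), of m "t - m"] assms(4,5) by simp
  moreover have "stochastic (lprod (\<lambda>i. s (i + m)) (t - m))" "stochastic (lprod s m)"
    using assms(1,2) by (auto intro: stochastic_lprod product_over_shift)
  moreover have "fst (pair_step (lprod s m) P) \<inter> snd (pair_step (lprod s m) P) = {}"
    using calculation(3) assms(3) by (intro pair_step_disjoint) (auto simp: disjoint_pairs_iff)
  ultimately show ?thesis using pair_step_in_disjoint_pairsD by blast
qed

lemma periodic_lprod_add:
  assumes "periodic_with p s"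
  shows "lprod s (p + t) = lprod s t ** lprod s p"
proof -
  have "lprod (\<lambda>i. s (i + p)) t = lprod s t"
    using assms by (intro lprod_cong) (simp add: periodic_with_def)
  then show ?thesis by (simp add: lprod_add)
qed

lemma periodic_extension:
  assumes "0 < p" "product_over \<Sigma> s"
  obtains s' where "product_over \<Sigma> s'" "periodic_with p s'" "lprod s' p = lprod s p"
proof
  \<comment> \<open>Products start at index 1, so \<open>i - 1\<close> is reduced modulo
    \<open>p\<close> and the result shifted back into \<open>1..p\<close>.\<close>
  let ?s = "\<lambda>i. s (Suc ((i - 1) mod p))"
  show "product_over \<Sigma> ?s" using assms(2) by (simp add: product_over_def)
  show "periodic_with p ?s" by (auto simp: periodic_with_def Suc_le_eq gr0_conv_Suc)
  show "lprod ?s p = lprod s p"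
    using assms(1) by (intro lprod_cong) auto
qed

text \<open>Only growth of the pair is required, not an exact return: this is what makes the pairs along a
  shortest cycle incomparable.\<close>
definition pair_cycle :: "(real^'n^'n) set \<Rightarrow> nat \<Rightarrow> (nat \<Rightarrow> real^'n^'n) \<Rightarrow> 'n set \<times> 'n set \<Rightarrow> bool" where
  "pair_cycle \<Sigma> p s P \<longleftrightarrow>
     0 < p \<and> product_over \<Sigma> s \<and> P \<in> disjoint_pairs \<and> pair_le P (pair_step (lprod s p) P)"

context
  fixes \<Sigma> :: "(real^'n^'n) set"
  assumes st: "\<forall>A\<in>\<Sigma>. stochastic A"
begin

text \<open>The full period acts first and enlarges \<open>P\<close>; the remaining \<open>t\<close>
  factors act monotonically.\<close>

lemma pair_cycle_add:
  assumes "pair_cycle \<Sigma> p s P" "periodic_with p s"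
  shows "pair_le (pair_step (lprod s t) P) (pair_step (lprod s (p + t)) P)"
proof -
  have "stochastic (lprod s t)" "stochastic (lprod s p)"
    using assms(1) st by (auto simp: pair_cycle_def intro: stochastic_lprod)
  then have "pair_step (lprod s (p + t)) P = pair_step (lprod s t) (pair_step (lprod s p) P)"
    using assms(2) by (simp add: periodic_lprod_add pair_step_mult)
  then show ?thesis using assms(1) by (simp add: pair_cycle_def pair_step_mono)
qed

text \<open>At multiples of \<open>p\<close> the pair dominates \<open>P\<close>, so neither
  component is empty. Between them none can be empty either, because it would never recover.\<close>

lemma pair_cycle_stays_disjoint:
  assumes "pair_cycle \<Sigma> p s P" "periodic_with p s"
  shows "pair_step (lprod s t) P \<in> disjoint_pairs"
proof -
  have po: "product_over \<Sigma> s" and P: "P \<in> disjoint_pairs" and p: "0 < p"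
    using assms(1) by (auto simp: pair_cycle_def)
  have "pair_le P (pair_step (lprod s (p * k)) P)" for k
  proof (induction k)
    case 0
    then show ?case by (simp add: pair_le_refl)
  next
    case (Suc k)
    then show ?case using pair_cycle_add[OF assms, of "p * k"] pair_le_trans by simp
  qed
  then have "pair_step (lprod s (p * t)) P \<in> disjoint_pairs"
    using P pair_step_disjoint[OF stochastic_lprod[OF st po]] disjoint_pairs_pair_le
    by (metis disjoint_pairs_iff)
  moreover have "t \<le> p * t" using p by simp
  ultimately show ?thesis using pair_step_lprod_prefix[OF st po P] by blast
qed

lemma minimal_pair_cycle_le_pstar:
  assumes "pair_cycle \<Sigma> p s P" "periodic_with p s"
    and min: "\<And>q s P. q < p \<Longrightarrow> \<not> pair_cycle \<Sigma> q s P"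
  shows "p \<le> pstar CARD('n)"
proof -
  have po: "product_over \<Sigma> s" using assms(1) by (simp add: pair_cycle_def)
  define Q where "Q t = pair_step (lprod s t) P" for t
  have dis: "Q t \<in> disjoint_pairs" for t
    unfolding Q_def by (rule pair_cycle_stays_disjoint[OF assms(1,2)])
  \<comment> \<open>Otherwise the sequence shifted by \<open>i\<close>, started at
    \<open>Q i\<close>, would be a cycle of length \<open>q < p\<close>.\<close>
  have no: "\<not> pair_le (Q i) (Q (i + q))" if "0 < q" "q < p" for i q
  proof
    assume "pair_le (Q i) (Q (i + q))"
    then have "pair_cycle \<Sigma> q (\<lambda>j. s (j + i)) (Q i)"
      using that po dis pair_step_lprod_add[OF st po, of i q P]
      by (simp add: pair_cycle_def product_over_shift Q_def)
    then show False using min that by blast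
  qed
  have incomparable: "\<not> pair_le (Q i) (Q j)" if "i < p" "j < p" "i \<noteq> j" for i j
  proof (cases "i < j")
    case True
    then show ?thesis using no[of "j - i" i] that by simp
  next
    case False
    show ?thesis
    proof
      \<comment> \<open>For \<open>j < i\<close> the comparison is carried one period onward, from
        time \<open>j\<close> to \<open>p + j\<close>, which leaves a gap \<open>p + j - i\<close>
        below \<open>p\<close>.\<close>
      assume "pair_le (Q i) (Q j)"
      moreover have "pair_le (Q j) (Q (p + j))"
        unfolding Q_def by (rule pair_cycle_add[OF assms(1,2)])
      ultimately have "pair_le (Q i) (Q (i + (p + j - i)))"
        using that pair_le_trans by simp
      moreover have "0 < p + j - i" "p + j - i < p" using that False by linarith+
      ultimately show False using no by blast
    qed
  qed
  let ?G = "Q ` {..<p}"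
  have inj: "inj_on Q {..<p}"
  proof (rule inj_onI)
    fix i j assume "i \<in> {..<p}" "j \<in> {..<p}" "Q i = Q j"
    then show "i = j" using incomparable[of i j] pair_le_refl[of "Q j"] by auto
  qed
  \<comment> \<open>Mirror images are new elements, so the family doubles to
    \<open>2 * p\<close>.\<close>
  have noswap: "prod.swap (Q i) \<noteq> Q j" if "i < p" "j < p" for i j
  proof (cases "i = j")
    case True
    then show ?thesis using dis[of i] by (cases "Q i") (auto simp: disjoint_pairs_def)
  next
    case False
    then show ?thesis using incomparable[OF that] by (auto simp: pair_le_def)
  qed
  have "card (?G \<union> prod.swap ` ?G) = card ?G + card (prod.swap ` ?G)"
    using noswap by (intro card_Un_disjoint) fastforce+
  also have "\<dots> = 2 * p"
    using inj by (simp add: card_image)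
  finally have "card (?G \<union> prod.swap ` ?G) = 2 * p" .
  moreover have "card (?G \<union> prod.swap ` ?G) \<le> 2 * pstar CARD('n)"
  proof (rule card_antichain_disjoint_pairs_le)
    have "prod.swap (Q t) \<in> disjoint_pairs" for t
      using dis[of t] by (simp add: disjoint_pairs_iff Int_commute)
    then show "?G \<union> prod.swap ` ?G \<subseteq> disjoint_pairs"
      using dis by blast
    fix U V assume "U \<in> ?G \<union> prod.swap ` ?G" "V \<in> ?G \<union> prod.swap ` ?G"
    then obtain i j where ij: "i < p" "j < p" "U = Q i \<or> U = prod.swap (Q i)" "V = Q j \<or> V = prod.swap (Q j)"
      by blast
    show "\<not> U < V"
    proof
      assume less: "U < V"
      then have "pair_le (Q i) (Q j)"
        using ij(3,4) by (cases "Q i"; cases "Q j") (auto simp: pair_le_def less_prod_def)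
      then have "i = j" using incomparable ij by blast
      then have "pair_size U = pair_size V" using ij(3,4) by (auto simp: pair_size_def)
      then show False using pair_size_less[OF less] by simp
    qed
  qed
  ultimately show ?thesis by simp
qed

text \<open>The rows witnessing the two components of the pair keep the weights \<open>1\<close> and \<open>0\<close> on the first
  component of \<open>P\<close>, whereas equal rows in the limit would force these weights to merge.\<close>
lemma persistent_pair_not_rank_1:
  assumes po: "product_over \<Sigma> s" and dis: "fst P \<inter> snd P = {}"
    and pers: "\<And>t. pair_step (lprod s t) P \<in> disjoint_pairs"
    and lim: "lprod s \<longlonglongrightarrow> M"
  shows "rank M \<noteq> 1"
proof
  assume r: "rank M = 1"
  have stW: "stochastic (lprod s t)" for t using st po by (rule stochastic_lprod)
  have lim': "(\<lambda>t. lprod s t $ i $ j) \<longlonglongrightarrow> M $ i $ j" for i j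
    by (intro tendsto_vec_nth lim)
  have sums: "(\<Sum>j\<in>UNIV. M $ i $ j) = 1" for i
  proof -
    have "(\<lambda>t. \<Sum>j\<in>UNIV. lprod s t $ i $ j) \<longlonglongrightarrow> (\<Sum>j\<in>UNIV. M $ i $ j)"
      by (intro tendsto_sum lim')
    then show ?thesis using stW by (simp add: stochastic_row_sum LIMSEQ_const_iff)
  qed
  \<comment> \<open>All rows of \<open>M\<close> will agree, so the arbitrary row
    \<open>undefined\<close> represents them.\<close>
  define c where "c = (\<Sum>j\<in>fst P. M $ undefined $ j)"
  define w where "w t i = (\<Sum>j\<in>fst P. lprod s t $ i $ j)" for t i
  have "(\<lambda>t. w t i) \<longlonglongrightarrow> c" for i
  proof -
    have "(\<lambda>t. w t i) \<longlonglongrightarrow> (\<Sum>j\<in>fst P. M $ i $ j)"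
      unfolding w_def by (intro tendsto_sum lim')
    then show ?thesis using rank_1_imp_rows_eq[OF r sums, of i undefined] by (simp add: c_def)
  qed
  then have "\<forall>\<^sub>F t in sequentially. dist (w t i) c < 1/2" for i
    by (rule tendstoD) simp
  \<comment> \<open>There are finitely many rows, so one time \<open>t\<close> serves them all. No
    \<open>c\<close> is closer than \<open>1/2\<close> to both weights 1 and 0.\<close>
  then have "\<forall>\<^sub>F t in sequentially. \<forall>i\<in>UNIV. dist (w t i) c < 1/2"
    by (intro eventually_ball_finite) auto
  then obtain t where t: "\<And>i. dist (w t i) c < 1/2"
    using eventually_happens by fastforce
  obtain i k where i: "i \<in> rows_inside (lprod s t) (fst P)" and k: "k \<in> rows_inside (lprod s t) (snd P)"
    using pers[of t] by (auto simp: disjoint_pairs_iff pair_step_def)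
  have "w t i = (\<Sum>j\<in>UNIV. lprod s t $ i $ j)"
    unfolding w_def using i by (intro sum.mono_neutral_left) (auto simp: rows_inside_def)
  then have "w t i = 1" using stW by (simp add: stochastic_row_sum)
  moreover have "w t k = 0"
    unfolding w_def using k dis by (intro sum.neutral) (auto simp: rows_inside_def)
  ultimately show False using t[of i] t[of k] by (auto simp: dist_real_def)
qed

text \<open>Two rows of the product with disjoint supports would give a pair that survives all
  \<open>N\<close> steps. By pigeonhole it repeats, and a repetition is a cycle.\<close>

lemma scrambling_if_no_pair_cycle:
  assumes "\<And>p s P. \<not> pair_cycle \<Sigma> p s P"
  defines "N \<equiv> CARD('n set \<times> 'n set)"
  assumes po: "product_over \<Sigma> s"
  shows "\<exists>k. lprod s N $ i $ k \<noteq> 0 \<and> lprod s N $ j $ k \<noteq> 0"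
proof (rule ccontr)
  assume contra: "\<nexists>k. lprod s N $ i $ k \<noteq> 0 \<and> lprod s N $ j $ k \<noteq> 0"
  have stW: "stochastic (lprod s t)" for t using st po by (rule stochastic_lprod)
  define P where "P = ({k. lprod s N $ i $ k \<noteq> 0}, {k. lprod s N $ j $ k \<noteq> 0})"
  have P: "P \<in> disjoint_pairs"
    using contra stochastic_row_nonzero[OF stW[of N], of i] stochastic_row_nonzero[OF stW[of N], of j]
    by (auto simp: P_def disjoint_pairs_def)
  have "i \<in> fst (pair_step (lprod s N) P)" "j \<in> snd (pair_step (lprod s N) P)"
    by (auto simp: pair_step_def P_def rows_inside_def)
  moreover have "fst (pair_step (lprod s N) P) \<inter> snd (pair_step (lprod s N) P) = {}"
    using P by (intro pair_step_disjoint stW) (simp add: disjoint_pairs_iff)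
  ultimately have last: "pair_step (lprod s N) P \<in> disjoint_pairs"
    by (auto simp: disjoint_pairs_iff)
  \<comment> \<open>There are \<open>N + 1\<close> times \<open>0..N\<close> but only
    \<open>N\<close> pairs of sets in all.\<close>
  have "\<not> inj_on (\<lambda>t. pair_step (lprod s t) P) {..N}"
  proof
    assume "inj_on (\<lambda>t. pair_step (lprod s t) P) {..N}"
    from card_inj_on_le[OF this subset_UNIV] show False by (simp add: N_def)
  qed
  then obtain a b where ab: "a < b" "b \<le> N" "pair_step (lprod s a) P = pair_step (lprod s b) P"
    unfolding inj_on_def by (metis atMost_iff linorder_neqE_nat)
  have "pair_step (lprod s a) P \<in> disjoint_pairs"
    using pair_step_lprod_prefix[OF st po P _ last] ab by simp
  moreover have "pair_step (lprod (\<lambda>i. s (i + a)) (b - a)) (pair_step (lprod s a) P) = pair_step (lprod s a) P"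
    using pair_step_lprod_add[OF st po, of a "b - a" P] ab by simp
  ultimately have "pair_cycle \<Sigma> (b - a) (\<lambda>i. s (i + a)) (pair_step (lprod s a) P)"
    using ab po by (simp add: pair_cycle_def product_over_shift pair_le_refl)
  then show False using assms(1) by blast
qed

end

subsection \<open>Contraction under scrambling matrices\<close>

lemma uniformly_scrambling:
  fixes F :: "(real^'n^'n) set"
  assumes "finite F" "\<forall>W\<in>F. stochastic W"
    and "\<forall>W\<in>F. \<forall>i j. \<exists>k. W $ i $ k \<noteq> 0 \<and> W $ j $ k \<noteq> 0"
  obtains \<mu> where "0 < \<mu>" "\<forall>W\<in>F. \<forall>i j. \<exists>k. \<mu> \<le> W $ i $ k \<and> \<mu> \<le> W $ j $ k"
proof
  \<comment> \<open>Inserting 1 keeps \<open>E\<close> nonempty, so that \<open>Min E\<close> is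
    meaningful even for empty \<open>F\<close>.\<close>
  define E where "E = insert 1 ((\<lambda>(W, i, k). W $ i $ k) ` (F \<times> UNIV \<times> UNIV) - {0})"
  have fin: "finite E" using assms(1) by (simp add: E_def)
  have "\<forall>e\<in>E. 0 < e"
    using assms(2) by (force simp: E_def stochastic_def less_le)
  then show "0 < Min E" using fin by (subst Min_gr_iff) (auto simp: E_def)
  have "Min E \<le> W $ i $ k" if "W \<in> F" "W $ i $ k \<noteq> 0" for W i k
  proof -
    have "(\<lambda>(W, i, k). W $ i $ k) (W, i, k) \<in> (\<lambda>(W, i, k). W $ i $ k) ` (F \<times> UNIV \<times> UNIV)"
      using that by (intro imageI) simp
    then have "W $ i $ k \<in> E" unfolding E_def using that by simp
    then show ?thesis using fin by simp
  qed
  then show "\<forall>W\<in>F. \<forall>i j. \<exists>k. Min E \<le> W $ i $ k \<and> Min E \<le> W $ j $ k"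
    using assms(3) by meson
qed

text \<open>The gap between \<open>b\<close> and the weighted average is a sum of nonnegative terms,
  bounded below by its term at \<open>k\<close>.\<close>

lemma stochastic_mult_vec_le:
  assumes "stochastic W" "\<And>l. x $ l \<le> b"
  shows "(W *v x) $ i \<le> b - W $ i $ k * (b - x $ k)"
proof -
  have "W $ i $ k * (b - x $ k) \<le> (\<Sum>l\<in>UNIV. W $ i $ l * (b - x $ l))"
    using assms by (intro member_le_sum) (auto simp: stochastic_nonneg)
  also have "\<dots> = b - (W *v x) $ i"
    using stochastic_row_sum[OF assms(1), of i]
    by (simp add: right_diff_distrib sum_subtractf sum_distrib_right[symmetric] matrix_vector_mult_def)
  finally show ?thesis by simp
qed

lemma stochastic_mult_vec_ge:
  assumes "stochastic W" "\<And>l. a \<le> x $ l"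
  shows "a + W $ i $ k * (x $ k - a) \<le> (W *v x) $ i"
  using stochastic_mult_vec_le[of W "- x" "- a" i k] assms
  by (simp add: mult_minus_right vec.neg)

section \<open>The oscillation of a vector\<close>

definition vec_max :: "real^'n \<Rightarrow> real" where "vec_max x = Max (range (($) x))"
definition vec_min :: "real^'n \<Rightarrow> real" where "vec_min x = Min (range (($) x))"

lemma vec_max_ge: "x $ i \<le> vec_max x" and vec_min_le: "vec_min x \<le> x $ i"
  by (simp_all add: vec_max_def vec_min_def)

lemma vec_max_attained: "\<exists>i. vec_max x = x $ i" and vec_min_attained: "\<exists>i. vec_min x = x $ i"
proof -
  have "Max (range (($) x)) \<in> range (($) x)" "Min (range (($) x)) \<in> range (($) x)"
    by (intro Max_in Min_in; simp)+
  then show "\<exists>i. vec_max x = x $ i" "\<exists>i. vec_min x = x $ i"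
    unfolding vec_max_def vec_min_def by blast+
qed

lemma vec_max_mult_le:
  assumes "stochastic W" shows "vec_max (W *v x) \<le> vec_max x"
proof -
  obtain i where i: "vec_max (W *v x) = (W *v x) $ i" using vec_max_attained by blast
  have "0 \<le> W $ i $ i * (vec_max x - x $ i)"
    using assms by (simp add: stochastic_nonneg vec_max_ge)
  then show ?thesis using stochastic_mult_vec_le[OF assms vec_max_ge, of x i i] i by linarith
qed

lemma vec_min_mult_ge:
  assumes "stochastic W" shows "vec_min x \<le> vec_min (W *v x)"
proof -
  obtain i where i: "vec_min (W *v x) = (W *v x) $ i" using vec_min_attained by blast
  have "0 \<le> W $ i $ i * (x $ i - vec_min x)"
    using assms by (simp add: stochastic_nonneg vec_min_le)
  then show ?thesis using stochastic_mult_vec_ge[OF assms vec_min_le, of x i i] i by linarith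
qed

text \<open>The rows attaining the maximum and the minimum share a column \<open>k\<close> of weight
  at least \<mu>. The entry \<open>x $ k\<close> pulls one down and the other up, by \<mu> times the
  old oscillation in total.\<close>

lemma oscillation_contraction:
  assumes "stochastic W" and scr: "\<forall>i j. \<exists>k. \<mu> \<le> W $ i $ k \<and> \<mu> \<le> W $ j $ k"
  shows "vec_max (W *v x) - vec_min (W *v x) \<le> (1 - \<mu>) * (vec_max x - vec_min x)"
proof -
  obtain i where i: "vec_max (W *v x) = (W *v x) $ i" using vec_max_attained by blast
  obtain j where j: "vec_min (W *v x) = (W *v x) $ j" using vec_min_attained by blast
  obtain k where k: "\<mu> \<le> W $ i $ k" "\<mu> \<le> W $ j $ k" using scr by blast
  have "\<mu> * (vec_max x - x $ k) \<le> W $ i $ k * (vec_max x - x $ k)"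
    "\<mu> * (x $ k - vec_min x) \<le> W $ j $ k * (x $ k - vec_min x)"
    using k by (auto intro!: mult_right_mono simp: vec_max_ge vec_min_le)
  then have "(W *v x) $ i - (W *v x) $ j \<le>
     (vec_max x - \<mu> * (vec_max x - x $ k)) - (vec_min x + \<mu> * (x $ k - vec_min x))"
    using stochastic_mult_vec_le[OF assms(1) vec_max_ge, of x i k]
      stochastic_mult_vec_ge[OF assms(1) vec_min_le, of x j k] by linarith
  then show ?thesis unfolding i j by (simp add: algebra_simps)
qed

lemma lprod_vec_converges_to_constant:
  assumes st: "\<forall>A\<in>\<Sigma>. stochastic A" and po: "product_over \<Sigma> s"
    and "0 < \<mu>"
    and scr: "\<And>s i j. product_over \<Sigma> s \<Longrightarrow> \<exists>k. \<mu> \<le> lprod s N $ i $ k \<and> \<mu> \<le> lprod s N $ j $ k"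
  shows "\<exists>c. \<forall>i. (\<lambda>t. (lprod s t *v x) $ i) \<longlonglongrightarrow> c"
proof -
  define y where "y t = lprod s t *v x" for t
  have y_add: "y (m + t) = lprod (\<lambda>i. s (i + m)) t *v y m" for m t
    by (simp add: y_def lprod_add matrix_vector_mul_assoc)
  have stW: "stochastic (lprod (\<lambda>i. s (i + m)) t)" for m t
    using st product_over_shift[OF po] by (rule stochastic_lprod)
  have max_le: "vec_max (y n) \<le> vec_max (y m)" and min_le: "vec_min (y m) \<le> vec_min (y n)" if "m \<le> n" for m n
    using that y_add[of m "n - m"] vec_max_mult_le[OF stW, of m "n - m" "y m"]
      vec_min_mult_ge[OF stW, of "y m" m "n - m"] by simp_all
  have min_max: "vec_min v \<le> vec_max v" for v :: "real^'a"
    using vec_min_le[of v undefined] vec_max_ge[of v undefined] by linarith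
  have "decseq (\<lambda>t. vec_max (y t))" using max_le by (simp add: decseq_def)
  moreover have "\<forall>t. vec_min (y 0) \<le> vec_max (y t)"
    using min_le[of 0] min_max order_trans by blast
  ultimately obtain b where b: "(\<lambda>t. vec_max (y t)) \<longlonglongrightarrow> b" by (rule decseq_convergent)
  have "incseq (\<lambda>t. vec_min (y t))" using min_le by (simp add: incseq_def)
  moreover have "\<forall>t. vec_min (y t) \<le> vec_max (y 0)"
    using max_le[of 0] min_max order_trans by blast
  ultimately obtain a where a: "(\<lambda>t. vec_min (y t)) \<longlonglongrightarrow> a" by (rule incseq_convergent)
  define d where "d t = vec_max (y t) - vec_min (y t)" for t
  \<comment> \<open>The scrambling bound holds for all sequences, hence for every window of
    \<open>N\<close> factors.\<close>
  have d_add: "d (m + N) \<le> (1 - \<mu>) * d m" for m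
    unfolding d_def y_add using scr[OF product_over_shift[OF po]]
    by (intro oscillation_contraction stW) auto
  have d: "d \<longlonglongrightarrow> b - a" unfolding d_def by (intro tendsto_diff a b)
  have "(\<lambda>t. d (t + N)) \<longlonglongrightarrow> b - a" by (rule LIMSEQ_ignore_initial_segment[OF d])
  \<comment> \<open>Monotonicity already gives a limit for the oscillation; the contraction passes
    to this limit and forces it to be 0.\<close>
  then have "b - a \<le> (1 - \<mu>) * (b - a)"
    using d_add by (intro LIMSEQ_le[OF _ tendsto_mult_left[OF d]]) auto
  then have "\<mu> * (b - a) \<le> 0" by (simp add: algebra_simps)
  then have "b \<le> a" using \<open>0 < \<mu>\<close> by (simp add: mult_le_0_iff)
  moreover have "a \<le> b" using a b min_max by (intro LIMSEQ_le[OF a b]) auto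
  ultimately have "a = b" by simp
  have "(\<lambda>t. y t $ i) \<longlonglongrightarrow> b" for i
    using a b unfolding \<open>a = b\<close>
    by (rule real_tendsto_sandwich[rotated 2]) (auto simp: vec_min_le vec_max_ge)
  then show ?thesis by (auto simp: y_def)
qed

section \<open>The equivalence for all products and for short periodic ones\<close>

theorem theorem4:
  fixes \<Sigma> :: "(real^'n^'n) set"
  assumes "finite \<Sigma>"
    and "\<forall>A\<in>\<Sigma>. stochastic A"
  shows "(\<forall>s. product_over \<Sigma> s \<longrightarrow> (\<exists>M. lip_converges_to s M \<and> rank M = 1))
     \<longleftrightarrow> (\<forall>s p. product_over \<Sigma> s \<and> 1 \<le> p \<and> p \<le> pstar CARD('n) \<and> periodic_with p s
              \<longrightarrow> (\<exists>M. lip_converges_to s M \<and> rank M = 1))"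
proof
  assume per: "\<forall>s p. product_over \<Sigma> s \<and> 1 \<le> p \<and> p \<le> pstar CARD('n) \<and> periodic_with p s
              \<longrightarrow> (\<exists>M. lip_converges_to s M \<and> rank M = 1)"
  have no_cycle: "\<not> pair_cycle \<Sigma> p s P" for p s P
  proof
    assume "pair_cycle \<Sigma> p s P"
    then have ex: "\<exists>p s P. pair_cycle \<Sigma> p s P" by blast
    \<comment> \<open>Minimality ranges over all sequences and pairs, since cutting a cycle shorter
      changes both.\<close>
    define q where "q = (LEAST q. \<exists>s P. pair_cycle \<Sigma> q s P)"
    obtain s P where sP: "pair_cycle \<Sigma> q s P"
      using LeastI_ex[OF ex] unfolding q_def by blast
    have min: "\<not> pair_cycle \<Sigma> q' s P" if "q' < q" for q' s P
      using not_less_Least[of q'] that unfolding q_def by blast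
    have "0 < q" "product_over \<Sigma> s" using sP by (auto simp: pair_cycle_def)
    then obtain s' where s': "product_over \<Sigma> s'" "periodic_with q s'" "lprod s' q = lprod s q"
      by (rule periodic_extension)
    have cyc: "pair_cycle \<Sigma> q s' P" using sP s' by (simp add: pair_cycle_def)
    then have "q \<le> pstar CARD('n)"
      using minimal_pair_cycle_le_pstar[OF assms(2) _ s'(2)] min by blast
    then obtain M where M: "lprod s' \<longlonglongrightarrow> M" "rank M = 1"
      using per s' \<open>0 < q\<close> unfolding lip_converges_to_def by (metis One_nat_def Suc_leI)
    show False
      using persistent_pair_not_rank_1[OF assms(2) s'(1) _ pair_cycle_stays_disjoint[OF assms(2) cyc s'(2)] M(1)]
        M(2) cyc by (simp add: pair_cycle_def disjoint_pairs_iff)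
  qed
  define N where "N = CARD('n set \<times> 'n set)"
  let ?F = "{lprod s N | s. product_over \<Sigma> s}"
  have "\<forall>W\<in>?F. stochastic W" using stochastic_lprod[OF assms(2)] by blast
  moreover have "\<forall>W\<in>?F. \<forall>i j. \<exists>k. W $ i $ k \<noteq> 0 \<and> W $ j $ k \<noteq> 0"
    using scrambling_if_no_pair_cycle[OF assms(2) no_cycle] unfolding N_def by blast
  ultimately obtain \<mu> where \<mu>: "0 < \<mu>"
    and scr: "\<forall>W\<in>?F. \<forall>i j. \<exists>k. \<mu> \<le> W $ i $ k \<and> \<mu> \<le> W $ j $ k"
    by (rule uniformly_scrambling[OF finite_lprods[OF assms(1)]])
  show "\<forall>s. product_over \<Sigma> s \<longrightarrow> (\<exists>M. lip_converges_to s M \<and> rank M = 1)"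
  proof (intro allI impI)
    fix s assume po: "product_over \<Sigma> s"
    \<comment> \<open>Applied to the \<open>j\<close>-th unit vector, the product yields its
      \<open>j\<close>-th column.\<close>
    have "\<exists>c. \<forall>i. (\<lambda>t. (lprod s t *v axis j 1) $ i) \<longlonglongrightarrow> c" for j
      using lprod_vec_converges_to_constant[OF assms(2) po \<mu>, where N = N] scr by blast
    then have "\<exists>c. \<forall>i. (\<lambda>t. lprod s t $ i $ j) \<longlonglongrightarrow> c" for j
      by (simp add: matrix_vector_mul_component inner_axis)
    then obtain v where v: "\<And>i j. (\<lambda>t. lprod s t $ i $ j) \<longlonglongrightarrow> v j" by metis
    define M :: "real^'n^'n" where "M = (\<chi> i. \<chi> j. v j)"
    have "lprod s \<longlonglongrightarrow> M"
      using v by (intro vec_tendstoI) (simp add: M_def)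
    have "(\<lambda>t. \<Sum>j\<in>UNIV. lprod s t $ undefined $ j) \<longlonglongrightarrow> (\<Sum>j\<in>UNIV. v j)"
      by (intro tendsto_sum v)
    then have "(\<Sum>j\<in>UNIV. v j) = 1"
      using stochastic_lprod[OF assms(2) po] by (simp add: stochastic_row_sum LIMSEQ_const_iff)
    then have "\<exists>j. v j \<noteq> 0" by (metis sum.neutral zero_neq_one)
    then have "(\<chi> j. v j) \<noteq> 0" by (simp add: vec_eq_iff)
    then have "rank M = 1" unfolding M_def by (rule rank_constant_rows)
    then show "\<exists>M. lip_converges_to s M \<and> rank M = 1"
      using \<open>lprod s \<longlonglongrightarrow> M\<close> by (auto simp: lip_converges_to_def)
  qed
qed blast

end
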